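(* Let $n \geq 2$, $d \geq n$, and $\mathcal{D} := \mathcal{D}_1(d) \cap \mathcal{D}_{\infty}^{\leq}(n, m/(2 \log m))$. Then \[ \max_{Z \in \mathrm{Adv}(\mathcal{D})} p_{\textsc{Cluster}^*}(Z) = O\Big(\min\Big(1, \frac{nd}{m} \log\Big(1 + \frac{d}{n}\Big)\Big)\Big). \]
   Context: Fix $m\in\mathbb N$ and the universe of IDs $[m]=\{1,\dots,m\}$; $\log$ is base 2. An ID-generation algorithm is a randomized procedure producing a sequence of distinct IDs from $[m]$, one per request; different instances use independent randomness and do not communicate. An adaptive adversary $Z$ plays: starting from $D=()$, when $D=(d_1,\dots,d_i)$ it either activates a new instance and requests an ID from it ($D\gets(d_1,\dots,d_i,1)$), requests another ID from an existing instance $j$ ($d_j\gets d_j+1$), or stops, making $D$ final; it observes every ID produced and may adapt to it. A collision occurs if some ID is output by two different instances; $p_{\mathcal A}(Z)$ is the collision probability. For a set $\mathcal D$ of demand profiles, $\mathrm{Adv}(\mathcal D)$ is the set of adaptive adversaries that always stop eventually with final demand profile in $\mathcal D$. Notation: $\mathcal D_1(n',d)=\{D\in[m]^{n'}:\sum_i d_i=d\}$, $\mathcal D_1(d)=\bigcup_{i\ge 2}\mathcal D_1(i,d)$, and $\mathcal D_\infty^{\le}(n,h)=\bigcup_{2\le i\le n}[h]^i$ (profiles with between 2 and $n$ entries, each at most $h$). Algorithm $\textsc{Cluster}^*$: let $\mathrm{run}(x,r)=(x,x+1,\dots,x+r-1)$ modulo $m$; for $r=1,2,4,8,\dots$ in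 turn, the instance draws $x\in[m]$ uniformly at random among those for which $\mathrm{run}(x,r)$ does not intersect its previously chosen runs, and answers the next $r$ requests with the IDs of $\mathrm{run}(x,r)$ in order. $f=O(g)$ means $f\le c\,g$ for an absolute constant $c>0$ independent of all parameters. *)

theory Defs
  imports "HOL-Probability.Probability" "HOL-Probability.SPMF"
begin

section \<open>Demand profiles\<close>

type_synonym demand_profile = "nat list"

definition D1_len :: "nat \<Rightarrow> nat \<Rightarrow> nat \<Rightarrow> demand_profile set" where
  "D1_len m n' d = {D. length D = n' \<and> set D \<subseteq> {1..m} \<and> sum_list D = d}"

definition D1 :: "nat \<Rightarrow> nat \<Rightarrow> demand_profile set" where
  "D1 m d = (\<Union>i\<in>{2..}. D1_len m i d)"

text \<open>
  The bound \<open>h\<close> is real, as it will be \<open>m / (2 log m)\<close>; for such \<open>h\<close> the set \<open>[h]\<close> consists of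
  the integers between 1 and \<open>h\<close>.
\<close>
definition Dinf_le :: "nat \<Rightarrow> real \<Rightarrow> demand_profile set" where
  "Dinf_le n h = (\<Union>i\<in>{2..n}. {D. length D = i \<and> (\<forall>x\<in>set D. 1 \<le> x \<and> real x \<le> h)})"


section \<open>The game between an adaptive adversary and an ID-generation algorithm\<close>

text \<open>
  A history lists the answered requests as pairs (instance, ID), \<^emph>\<open>most recent first\<close>. Instances are
  numbered from 0 in the order of their activation.
\<close>
type_synonym history = "(nat \<times> nat) list"

fun profile :: "history \<Rightarrow> demand_profile" where
  "profile [] = []"
| "profile ((j, y) # h) =
     (let D = profile h in if j < length D then D[j := D ! j + 1] else D @ [1])"

datatype action = Activate | Request nat | Stop

text \<open>
  Adversaries may randomise their next action. Deterministic adversaries are those with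
  \<open>Z h = return_pmf (\<dots>)\<close> for all \<open>h\<close>.
\<close>
type_synonym adversary = "history \<Rightarrow> action pmf"

text \<open>
  \<open>always_stops m \<D> Z h\<close>: from the history \<open>h\<close> on, \<open>Z\<close> makes only legal moves and stops after
  finitely many of them with a final profile in \<open>\<D>\<close>, for all its own random choices and for all
  answers an ID-generation algorithm could give, i.e. IDs from \<open>{1..m}\<close> that the queried instance
  has not produced before. The condition \<open>profile h ! j < m\<close> says that there is such an ID.
  Being an inductive predicate, it excludes infinite plays.
\<close>
inductive always_stops :: "nat \<Rightarrow> demand_profile set \<Rightarrow> adversary \<Rightarrow> history \<Rightarrow> bool"
  for m :: nat and \<D> :: "demand_profile set" and Z :: adversary where
  "\<lbrakk> Stop \<in> set_pmf (Z h) \<Longrightarrow> profile h \<in> \<D>;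
     \<And>y. \<lbrakk> Activate \<in> set_pmf (Z h); y \<in> {1..m} \<rbrakk>
       \<Longrightarrow> always_stops m \<D> Z ((length (profile h), y) # h);
     \<And>j. Request j \<in> set_pmf (Z h) \<Longrightarrow> j < length (profile h) \<and> profile h ! j < m;
     \<And>j y. \<lbrakk> Request j \<in> set_pmf (Z h); y \<in> {1..m}; (j, y) \<notin> set h \<rbrakk>
       \<Longrightarrow> always_stops m \<D> Z ((j, y) # h) \<rbrakk>
   \<Longrightarrow> always_stops m \<D> Z h"

definition Adv :: "nat \<Rightarrow> demand_profile set \<Rightarrow> adversary set" where
  "Adv m \<D> = {Z. always_stops m \<D> Z []}"

text \<open>
  An algorithm is given by the initial state of an instance and a randomised transition that
  returns the next ID and the new state. Subprobability distributions allow for a transition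
  that is undefined, and for plays that do not end; \<open>play\<close> yields the distribution of the final
  history. The list \<open>\<sigma>\<close> holds the current states of the active instances; each instance has its
  own state, which the adversary does not see, and its own randomness.
\<close>
record 's id_alg =
  init :: 's
  answer :: "'s \<Rightarrow> (nat \<times> 's) spmf"

partial_function (spmf) play ::
  "'s id_alg \<Rightarrow> adversary \<Rightarrow> history \<Rightarrow> 's list \<Rightarrow> history spmf" where
  "play A Z h \<sigma> = bind_spmf (spmf_of_pmf (Z h)) (\<lambda>a. case a of
       Stop \<Rightarrow> return_spmf h
     | Activate \<Rightarrow> bind_spmf (answer A (init A))
         (\<lambda>(y, s). play A Z ((length \<sigma>, y) # h) (\<sigma> @ [s]))
     | Request j \<Rightarrow> bind_spmf (answer A (\<sigma> ! j))
         (\<lambda>(y, s). play A Z ((j, y) # h) (\<sigma>[j := s])))"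

definition collision :: "history \<Rightarrow> bool" where
  "collision h \<longleftrightarrow> (\<exists>i j y. i \<noteq> j \<and> (i, y) \<in> set h \<and> (j, y) \<in> set h)"

definition collision_prob :: "'s id_alg \<Rightarrow> adversary \<Rightarrow> real" where
  "collision_prob A Z = measure (measure_spmf (play A Z [] [])) {h. collision h}"


section \<open>The algorithm \<open>Cluster\<^sup>*\<close>\<close>

text \<open>The IDs are \<open>1, \<dots>, m\<close>, so \<open>m\<close> is followed by 1.\<close>
definition run :: "nat \<Rightarrow> nat \<Rightarrow> nat \<Rightarrow> nat list" where
  "run m x r = map (\<lambda>i. (x - 1 + i) mod m + 1) [0..<r]"

text \<open>
  The state consists of the union \<open>U\<close> of all runs chosen so far, the length \<open>r\<close> of the next run to
  be drawn, and the IDs of the current run that have not been handed out yet. A run is drawn when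
  the first of its IDs is requested. If no admissible starting point exists, \<open>spmf_of_set\<close> is the
  null distribution and the algorithm has no answer; for demands up to \<open>m / (2 log m)\<close> this does
  not happen.
\<close>
type_synonym cluster_state = "nat set \<times> nat \<times> nat list"

fun cluster_star_answer :: "nat \<Rightarrow> cluster_state \<Rightarrow> (nat \<times> cluster_state) spmf" where
  "cluster_star_answer m (U, r, y # ys) = return_spmf (y, (U, r, ys))"
| "cluster_star_answer m (U, r, []) =
     map_spmf (\<lambda>x. (hd (run m x r), (U \<union> set (run m x r), 2 * r, tl (run m x r))))
       (spmf_of_set {x \<in> {1..m}. set (run m x r) \<inter> U = {}})"

definition cluster_star :: "nat \<Rightarrow> cluster_state id_alg" where
  "cluster_star m = \<lparr> init = ({}, 1, []), answer = cluster_star_answer m \<rparr>"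

end

theory Submission
  imports Defs
begin

text \<open>
  A collision forces two instances to have reserved intersecting sets of IDs (\<open>overlap\<close>), so it
  suffices to bound the probability of that, even against an adversary who sees the full state.
  A run of length \<open>r\<close> has at least \<open>m/2\<close> admissible starting points, of which at most
  \<open>r + r'\<close> make it meet a given run of length \<open>r'\<close>. Hence a draw creates an overlap
  with probability at most \<open>2/m (K r + L)\<close>, where \<open>K\<close> and \<open>L\<close> are the number and the
  total length of the runs drawn so far. This is at most the increase of the potential \<open>2/m K L\<close>
  caused by the draw, and that increase does not depend on the random choice. Adaptivity is
  therefore harmless: the probability of an overlap is at most the largest possible final potential.
  There \<open>L \<le> 2d\<close>, and \<open>K \<le> 2n log(1 + d/n)\<close> by concavity of the logarithm.
\<close>

section \<open>Runs modulo \<open>m\<close> and the number of admissible starting points\<close>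

inductive reserved :: "nat \<Rightarrow> nat \<Rightarrow> nat set \<Rightarrow> bool" for m where
  reserved_0: "reserved m 0 {}"
| reserved_Suc: "\<lbrakk>reserved m k U; x \<in> {1..m}\<rbrakk> \<Longrightarrow> reserved m (Suc k) (U \<union> set (run m x (2 ^ k)))"

lemma set_run: "set (run m x r) = (\<lambda>i. (x - 1 + i) mod m + 1) ` {..<r}"
  by (auto simp: run_def)

lemma set_run_subset: "m \<ge> 1 \<Longrightarrow> set (run m x r) \<subseteq> {1..m}"
  by (auto simp: set_run Suc_le_eq)

text \<open>Adding the offset \<open>x - 1\<close> is injective modulo \<open>m\<close>, and the
  indices stay below \<open>r \<le> m\<close>. This keeps the pending IDs of an instance distinct
  from the one just answered.\<close>

lemma distinct_run: "r \<le> m \<Longrightarrow> distinct (run m x r)"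
proof -
  assume r: "r \<le> m"
  have "inj_on (\<lambda>i. (x - 1 + i) mod m + 1) {0..<r}"
  proof (rule inj_onI)
    fix i j assume "i \<in> {0..<r}" "j \<in> {0..<r}" "(x - 1 + i) mod m + 1 = (x - 1 + j) mod m + 1"
    then have eq: "(x - 1 + i) mod m = (x - 1 + j) mod m" and "i < m" "j < m" using r by auto
    have "(int (x - 1) + int i) mod int m = (int (x - 1) + int j) mod int m"
      using arg_cong[OF eq, of int] by (simp only: zmod_int of_nat_add)
    then have "(int (x - 1) + int i - int (x - 1)) mod int m = (int (x - 1) + int j - int (x - 1)) mod int m"
      by (metis mod_diff_left_eq)
    then show "i = j" using \<open>i < m\<close> \<open>j < m\<close> by simp
  qed
  then show ?thesis by (simp add: run_def distinct_map)
qed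

text \<open>If position \<open>i\<close> of the first run and position \<open>j\<close> of the
  second carry the same ID, then \<open>x\<close> is \<open>z\<close> shifted by
  \<open>j - i\<close> modulo \<open>m\<close>. As \<open>i < r\<close> and \<open>j < s\<close>,
  the shifts lie in an interval of \<open>r + s\<close> integers.\<close>

lemma card_runs_meeting_run:
  assumes "m \<ge> 1" "z \<in> {1..m}"
  shows "card {x \<in> {1..m}. set (run m x r) \<inter> set (run m z s) \<noteq> {}} \<le> r + s"
proof -
  let ?f = "\<lambda>t. nat ((int z - 1 + t) mod int m + 1)"
  have "{x \<in> {1..m}. set (run m x r) \<inter> set (run m z s) \<noteq> {}} \<subseteq> ?f ` {- int r..<int s}"
  proof
    fix x assume "x \<in> {x \<in> {1..m}. set (run m x r) \<inter> set (run m z s) \<noteq> {}}"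
    then obtain y where x: "x \<in> {1..m}" and "y \<in> set (run m x r)" "y \<in> set (run m z s)" by blast
    then obtain i j where ij: "i < r" "j < s" and "y = (x - 1 + i) mod m + 1" "y = (z - 1 + j) mod m + 1"
      unfolding set_run by blast
    then have eq: "(x - 1 + i) mod m = (z - 1 + j) mod m" by (metis add_right_cancel)
    have "int (x - 1) = int x - 1" "int (z - 1) = int z - 1" using x assms(2) by auto
    then have "(int x - 1 + int i) mod int m = (int z - 1 + int j) mod int m"
      using arg_cong[OF eq, of int] by (simp only: zmod_int of_nat_add)
    then have "(int x - 1 + int i - int i) mod int m = (int z - 1 + int j - int i) mod int m"
      by (metis mod_diff_left_eq)
    then have "(int z - 1 + (int j - int i)) mod int m = int x - 1"
      using x by (simp add: algebra_simps)
    then have "x = ?f (int j - int i)" by (simp only: diff_add_cancel nat_int)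
    then show "x \<in> ?f ` {- int r..<int s}" using ij by (intro image_eqI[of _ _ "int j - int i"]) auto
  qed
  then have "card {x \<in> {1..m}. set (run m x r) \<inter> set (run m z s) \<noteq> {}} \<le> card (?f ` {- int r..<int s})"
    by (intro card_mono) auto
  also have "\<dots> \<le> card {- int r..<int s}" by (intro card_image_le) auto
  also have "\<dots> = r + s" by simp
  finally show ?thesis .
qed

lemma reserved_subset: "reserved m k U \<Longrightarrow> m \<ge> 1 \<Longrightarrow> U \<subseteq> {1..m}"
  by (induction rule: reserved.induct) (simp, metis Un_least set_run_subset)

text \<open>Union bound: each of the \<open>k\<close> runs contributes \<open>r\<close> plus its own
  length, and the lengths 1, 2, 4, ... sum to \<open>2 ^ k - 1\<close>.\<close>

lemma card_runs_meeting_reserved: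
  assumes "reserved m k U" "m \<ge> 1"
  shows "card {x \<in> {1..m}. set (run m x r) \<inter> U \<noteq> {}} \<le> k * r + (2 ^ k - 1)"
  using assms
proof (induction rule: reserved.induct)
  case (reserved_Suc k U z)
  have "{x \<in> {1..m}. set (run m x r) \<inter> (U \<union> set (run m z (2 ^ k))) \<noteq> {}} =
    {x \<in> {1..m}. set (run m x r) \<inter> U \<noteq> {}} \<union> {x \<in> {1..m}. set (run m x r) \<inter> set (run m z (2 ^ k)) \<noteq> {}}"
    by auto
  then have "card {x \<in> {1..m}. set (run m x r) \<inter> (U \<union> set (run m z (2 ^ k))) \<noteq> {}} \<le>
    card {x \<in> {1..m}. set (run m x r) \<inter> U \<noteq> {}} +
    card {x \<in> {1..m}. set (run m x r) \<inter> set (run m z (2 ^ k)) \<noteq> {}}"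
    by (simp only: card_Un_le)
  also have "\<dots> \<le> (k * r + (2 ^ k - 1)) + (r + 2 ^ k)"
    by (intro add_mono reserved_Suc.IH card_runs_meeting_run reserved_Suc)
  also have "\<dots> = Suc k * r + (2 ^ Suc k - 1)"
    by (cases "(2::nat) ^ k") simp_all
  finally show ?case .
qed simp

text \<open>The quantity \<open>(k + 1) * 2 ^ k\<close> will bound the starting points that earlier
  runs block for a run of length \<open>2 ^ k\<close>. As \<open>log 2 m \<ge> 1\<close>, the
  assumption gives \<open>2 ^ (k + 1) \<le> m\<close>, so \<open>k + 1 \<le> log 2 m\<close>;
  inserting this into the assumption once more yields \<open>m / 2\<close>.\<close>

lemma run_count_bound:
  assumes "m \<ge> 1" "2 ^ k \<le> real m / (2 * log 2 (real m))"
  shows "real ((k + 1) * 2 ^ k) \<le> real m / 2" and "2 ^ k \<le> m"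
proof -
  \<comment> \<open>For \<open>m = 1\<close> the logarithm is 0 and division by 0 yields 0, so the
    assumption would read \<open>2 ^ k \<le> 0\<close>.\<close>
  have "m \<noteq> 1"
  proof
    assume "m = 1"
    with assms(2) have "2 ^ k \<le> (0::real)" by simp
    then show False using zero_less_power[of "2::real" k] by linarith
  qed
  with assms(1) have m: "m \<ge> 2" by simp
  then have L: "log 2 (real m) \<ge> 1" by (simp add: le_log_iff)
  have 1: "2 ^ k * (2 * log 2 (real m)) \<le> real m"
    using assms(2) L by (simp add: field_simps)
  have "2 ^ k * (2 * 1) \<le> 2 ^ k * (2 * log 2 (real m))"
    using L by (intro mult_left_mono) auto
  with 1 have 2: "2 ^ (k + 1) \<le> real m" by (simp only: power_add power_one_right mult_1_right)
  then have "real (k + 1) \<le> log 2 (real m)"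
    using m by (simp add: le_log_iff powr_add powr_realpow)
  then have "real (k + 1) * 2 ^ k \<le> log 2 (real m) * 2 ^ k"
    by (intro mult_right_mono) auto
  with 1 show "real ((k + 1) * 2 ^ k) \<le> real m / 2" by (simp add: algebra_simps)
  have "(2::real) ^ k \<le> 2 ^ (k + 1)" by simp
  with 2 have "real (2 ^ k) \<le> real m" by (simp only: of_nat_power of_nat_numeral)
  then show "2 ^ k \<le> m" by linarith
qed

text \<open>The instance's own runs block at most half of the starting points. Hence the next draw
  is possible, and it hits any fixed starting point with probability at most
  \<open>2 / m\<close>.\<close>

lemma card_admissible:
  assumes "reserved m k U" "m \<ge> 1" "2 ^ k \<le> real m / (2 * log 2 (real m))"
  shows "real m / 2 \<le> real (card {x \<in> {1..m}. set (run m x (2 ^ k)) \<inter> U = {}})"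
proof -
  let ?A = "{x \<in> {1..m}. set (run m x (2 ^ k)) \<inter> U = {}}"
  let ?B = "{x \<in> {1..m}. set (run m x (2 ^ k)) \<inter> U \<noteq> {}}"
  have "{1..m} = ?A \<union> ?B" "?A \<inter> ?B = {}" by blast+
  moreover have "finite ?A" "finite ?B" by auto
  ultimately have "card {1..m} = card ?A + card ?B" by (metis (no_types, lifting) card_Un_disjoint)
  then have "real m = real (card ?A) + real (card ?B)" by (simp only: card_atLeastAtMost of_nat_add diff_Suc_1 Suc_eq_plus1[symmetric])
  moreover have "card ?B \<le> k * 2 ^ k + (2 ^ k - 1)"
    using card_runs_meeting_reserved[OF assms(1,2)] .
  then have "card ?B \<le> (k + 1) * 2 ^ k" unfolding distrib_right by linarith
  then have "real (card ?B) \<le> real ((k + 1) * 2 ^ k)" by (rule of_nat_mono)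
  ultimately show ?thesis using run_count_bound(1)[OF assms(2,3)] by linarith
qed

section \<open>Histories, their profiles, and demands along a play\<close>

text \<open>Since \<open>profile\<close> appends an entry for any instance number out of range, this
  condition forces that number to be the next free one. Entry \<open>j\<close> of the profile then
  belongs to instance \<open>j\<close>.\<close>

fun legal :: "history \<Rightarrow> bool" where
  "legal [] \<longleftrightarrow> True"
| "legal ((j, y) # h) \<longleftrightarrow> j \<le> length (profile h) \<and> legal h"

lemma profile_Activate: "profile ((length (profile h), y) # h) = profile h @ [1]"
  by simp

lemma profile_Request: "j < length (profile h) \<Longrightarrow>
    profile ((j, y) # h) = (profile h)[j := profile h ! j + 1]"
  by (simp add: Let_def)

lemma legal_index_less: "legal h \<Longrightarrow> (j, y) \<in> set h \<Longrightarrow> j < length (profile h)"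
proof (induction h arbitrary: j y)
  case (Cons a h)
  obtain i z where a: "a = (i, z)" by force
  show ?case
  proof (cases "(j, y) \<in> set h")
    case True
    with Cons a have "j < length (profile h)" by simp
    then show ?thesis by (simp add: a Let_def)
  next
    case False
    then show ?thesis using Cons.prems by (auto simp: a Let_def)
  qed
qed simp

text \<open>Every answer of instance \<open>j\<close> raises its entry by one, while a repeated ID
  counts only once in the set; hence an inequality, which suffices for the pigeonhole argument
  below.\<close>

lemma card_answers_le:
  "legal h \<Longrightarrow> j < length (profile h) \<Longrightarrow> card {y. (j, y) \<in> set h} \<le> profile h ! j"
proof (induction h arbitrary: j)
  case (Cons a h)
  obtain i z where a: "a = (i, z)" by force
  have fin: "finite {y. (j, y) \<in> set h}"
    by (rule finite_subset[of _ "snd ` set h"]) force+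
  have eq: "{y. (j, y) \<in> set (a # h)} = (if i = j then insert z {y. (j, y) \<in> set h} else {y. (j, y) \<in> set h})"
    using a by auto
  show ?case
  proof (cases "j < length (profile h)")
    case True
    with Cons have "card {y. (j, y) \<in> set h} \<le> profile h ! j" by (simp add: a)
    moreover have "card {y. (j, y) \<in> set (a # h)} \<le> card {y. (j, y) \<in> set h} + (if i = j then 1 else 0)"
      unfolding eq using fin by (simp add: card_insert_if)
    moreover have "profile (a # h) ! j = profile h ! j + (if i = j then 1 else 0)"
      using True by (simp add: a Let_def nth_append)
    ultimately show ?thesis by linarith
  next
    case False
    \<comment> \<open>Here the latest request activates instance \<open>j\<close>, so both sides
      equal 1.\<close>
    have none: "{y. (j, y) \<in> set h} = {}"
      using False legal_index_less[of h j] Cons.prems(1) a by auto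
    have i: "i \<le> length (profile h)" "j < length (profile (a # h))"
      using Cons.prems by (auto simp: a)
    with False have "i = j" "j = length (profile h)"
      by (auto simp: a Let_def split: if_splits)
    with none show ?thesis unfolding eq by (simp add: a Let_def)
  qed
qed simp

text \<open>Guarantees that the quantification over possible answers in \<open>always_stops\<close>
  is not vacuous after a legal request.\<close>

lemma fresh_answer:
  assumes "legal h" "j < length (profile h)" "profile h ! j < m"
  shows "\<exists>y\<in>{1..m}. (j, y) \<notin> set h"
proof (rule ccontr)
  assume "\<not> ?thesis"
  then have "{1..m} \<subseteq> {y. (j, y) \<in> set h}" by blast
  moreover have "finite {y. (j, y) \<in> set h}"
    by (rule finite_subset[of _ "snd ` set h"]) force+
  ultimately have "card {1..m} \<le> card {y. (j, y) \<in> set h}" by (rule card_mono[rotated])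
  then show False using card_answers_le[OF assms(1,2)] assms(3) by simp
qed

text \<open>Entries only grow along a play, and some continuation ends in \<open>\<D>\<close>. This
  transfers the demand bound from final profiles to intermediate ones.\<close>

lemma always_stops_profile_le:
  assumes "always_stops m \<D> Z h" "legal h" "m \<ge> 1"
  shows "\<exists>D\<in>\<D>. length (profile h) \<le> length D \<and> (\<forall>j<length (profile h). profile h ! j \<le> D ! j)"
  using assms
proof (induction rule: always_stops.induct)
  case (1 h)
  obtain a where a: "a \<in> set_pmf (Z h)" using set_pmf_not_empty[of "Z h"] by blast
  show ?case
  proof (cases a)
    case Stop
    then show ?thesis using "1.hyps"(1) a by auto
  next
    case Activate
    \<comment> \<open>The ID 1 stands for an arbitrary answer of the new instance.\<close>
    have "legal ((length (profile h), 1) # h)" using "1.prems"(1) by simp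
    moreover have "1 \<in> {1..m}" using "1.prems"(2) by simp
    ultimately obtain D where "D \<in> \<D>" and
      "length (profile ((length (profile h), 1) # h)) \<le> length D"
      "\<forall>j<length (profile ((length (profile h), 1) # h)). profile ((length (profile h), 1) # h) ! j \<le> D ! j"
      using "1.IH"(1)[of 1] a Activate "1.prems"(2) by blast
    then show ?thesis unfolding profile_Activate
      by (intro bexI[of _ D]) (auto simp: nth_append less_Suc_eq)
  next
    case (Request j)
    with a "1.hyps"(3) have j: "j < length (profile h)" "profile h ! j < m" by auto
    then obtain y where y: "y \<in> {1..m}" "(j, y) \<notin> set h"
      using fresh_answer[OF "1.prems"(1)] by blast
    have "legal ((j, y) # h)" using "1.prems"(1) j by simp
    then obtain D where "D \<in> \<D>" and "length (profile ((j, y) # h)) \<le> length D"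
      "\<forall>i<length (profile ((j, y) # h)). profile ((j, y) # h) ! i \<le> D ! i"
      using "1.IH"(2)[of j y] a Request y "1.prems"(2) by blast
    then have "D \<in> \<D>" and D: "length (profile h) \<le> length D"
      "\<forall>i<length (profile h). (profile h)[j := profile h ! j + 1] ! i \<le> D ! i"
      unfolding profile_Request[OF j(1)] by auto
    have "profile h ! i \<le> D ! i" if "i < length (profile h)" for i
      using D(2)[rule_format, OF that] that by (cases "i = j") auto
    with \<open>D \<in> \<D>\<close> D(1) show ?thesis by blast
  qed
qed

section \<open>State invariant, overlaps and the potential\<close>

text \<open>
  The invariant of an instance that has answered \<open>p\<close> requests with the IDs in \<open>Y\<close>. The first
  \<open>k\<close> runs have total length \<open>2^k - 1 = r - 1\<close>; the condition \<open>r \<le> 2 * p + 1\<close> says that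
  the \<open>k\<close>-th run has been started.
\<close>
fun instance_ok :: "nat \<Rightarrow> nat \<Rightarrow> nat set \<Rightarrow> cluster_state \<Rightarrow> bool" where
  "instance_ok m p Y (U, r, ys) \<longleftrightarrow> (\<exists>k. r = 2 ^ k \<and> reserved m k U) \<and>
     length ys + p + 1 = r \<and> r \<le> 2 * p + 1 \<and> distinct ys \<and> set ys \<subseteq> U \<and> Y \<subseteq> U \<and> Y \<inter> set ys = {}"

definition consistent :: "nat \<Rightarrow> demand_profile \<Rightarrow> history \<Rightarrow> cluster_state list \<Rightarrow> bool" where
  "consistent m P h \<sigma> \<longleftrightarrow> length \<sigma> = length P \<and>
     (\<forall>j<length P. instance_ok m (P ! j) {y. (j, y) \<in> set h} (\<sigma> ! j))"

definition overlap :: "cluster_state list \<Rightarrow> bool" where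
  "overlap \<sigma> \<longleftrightarrow> (\<exists>i<length \<sigma>. \<exists>j<length \<sigma>. i \<noteq> j \<and> fst (\<sigma> ! i) \<inter> fst (\<sigma> ! j) \<noteq> {})"

text \<open>A state stores the length \<open>r = 2 ^ k\<close> of its next run, from which the
  number \<open>k\<close> of runs drawn and their total length \<open>2 ^ k - 1\<close> are read
  off.\<close>

abbreviation runs_drawn :: "cluster_state \<Rightarrow> real" where
  "runs_drawn s \<equiv> log 2 (real (fst (snd s)))"

abbreviation ids_reserved :: "cluster_state \<Rightarrow> real" where
  "ids_reserved s \<equiv> real (fst (snd s)) - 1"

definition potential :: "nat \<Rightarrow> cluster_state list \<Rightarrow> real" where
  "potential m \<sigma> = 2 / real m *
     ((\<Sum>i<length \<sigma>. runs_drawn (\<sigma> ! i)) * (\<Sum>i<length \<sigma>. ids_reserved (\<sigma> ! i)))"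

lemma consistent_instance_ok:
  "consistent m P h \<sigma> \<Longrightarrow> j < length P \<Longrightarrow> instance_ok m (P ! j) {y. (j, y) \<in> set h} (\<sigma> ! j)"
  by (simp add: consistent_def)

lemma consistent_update:
  assumes "consistent m P h \<sigma>" "j < length P"
    and "instance_ok m (P ! j + 1) (insert y {y. (j, y) \<in> set h}) s"
  shows "consistent m (P[j := P ! j + 1]) ((j, y) # h) (\<sigma>[j := s])"
proof -
  have "{z. (j, z) \<in> set ((j, y) # h)} = insert y {y. (j, y) \<in> set h}" by auto
  moreover have "{z. (i, z) \<in> set ((j, y) # h)} = {y. (i, y) \<in> set h}" if "i \<noteq> j" for i
    using that by auto
  ultimately show ?thesis using assms unfolding consistent_def
    by (metis length_list_update nth_list_update_eq nth_list_update_neq)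
qed

lemma measure_bind_spmf:
  "measure (measure_spmf (bind_spmf p f)) A = (\<integral>x. measure (measure_spmf (f x)) A \<partial>measure_spmf p)"
  by (simp add: measure_spmf_bind o_def measure_spmf.measure_bind[where N="count_space UNIV"])

text \<open>An average of values at most \<open>b\<close> is at most \<open>b\<close>; this reduces
  a randomised move of the adversary to the single actions in its support.\<close>

lemma measure_bind_spmf_of_pmf_le:
  assumes "\<And>x. x \<in> set_pmf p \<Longrightarrow> measure (measure_spmf (f x)) A \<le> b"
  shows "measure (measure_spmf (bind_spmf (spmf_of_pmf p) f)) A \<le> b"
proof -
  have "integrable (measure_pmf p) (\<lambda>x. measure (measure_spmf (f x)) A)"
    by (intro measure_pmf.integrable_const_bound[where B=1])
      (auto simp: measure_spmf.subprob_measure_le_1)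
  then have "(\<integral>x. measure (measure_spmf (f x)) A \<partial>measure_pmf p) \<le> (\<integral>x. b \<partial>measure_pmf p)"
    using assms by (intro integral_mono_AE) (auto simp: AE_measure_pmf_iff)
  then show ?thesis unfolding measure_bind_spmf by simp
qed

lemma runs_drawn_nonneg: "consistent m P h \<sigma> \<Longrightarrow> i < length \<sigma> \<Longrightarrow> 0 \<le> runs_drawn (\<sigma> ! i)"
  and ids_reserved_nonneg: "consistent m P h \<sigma> \<Longrightarrow> i < length \<sigma> \<Longrightarrow> 0 \<le> ids_reserved (\<sigma> ! i)"
proof -
  assume "consistent m P h \<sigma>" "i < length \<sigma>"
  then have "instance_ok m (P ! i) {y. (i, y) \<in> set h} (\<sigma> ! i)"
    by (simp add: consistent_def)
  then have "fst (snd (\<sigma> ! i)) \<ge> 1" by (cases "\<sigma> ! i") auto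
  then show "0 \<le> runs_drawn (\<sigma> ! i)" "0 \<le> ids_reserved (\<sigma> ! i)" by auto
qed

lemma card_runs_meeting_instance:
  assumes "instance_ok m p Y s" "m \<ge> 1"
  shows "real (card {x \<in> {1..m}. set (run m x r) \<inter> fst s \<noteq> {}}) \<le> runs_drawn s * r + ids_reserved s"
proof -
  obtain U q ys where s: "s = (U, q, ys)" by (cases s)
  with assms(1) obtain k where k: "q = 2 ^ k" "reserved m k U" by auto
  have "real (card {x \<in> {1..m}. set (run m x r) \<inter> U \<noteq> {}}) \<le> real (k * r + (2 ^ k - 1))"
    using card_runs_meeting_reserved[OF k(2) assms(2)] by (rule of_nat_mono)
  also have "\<dots> = runs_drawn s * r + ids_reserved s"
    unfolding of_nat_add using one_le_power[of "2::nat" k]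
    by (simp add: of_nat_diff s k(1) log_nat_power del: one_le_power)
  finally show ?thesis by (simp add: s)
qed

text \<open>Only the set of instance \<open>j\<close> changes, and only by adding \<open>R\<close>,
  so a new overlap must be one between \<open>R\<close> and another instance.\<close>

lemma overlap_update:
  assumes "overlap (\<sigma>[j := (U \<union> R, q, ys)])" "j < length \<sigma>" "fst (\<sigma> ! j) = U"
  shows "overlap \<sigma> \<or> (\<exists>i\<in>{..<length \<sigma>} - {j}. R \<inter> fst (\<sigma> ! i) \<noteq> {})"
proof -
  obtain a b where ab: "a < length \<sigma>" "b < length \<sigma>" "a \<noteq> b"
    "fst (\<sigma>[j := (U \<union> R, q, ys)] ! a) \<inter> fst (\<sigma>[j := (U \<union> R, q, ys)] ! b) \<noteq> {}"
    using assms(1) by (auto simp: overlap_def)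
  consider "a = j" "b \<noteq> j" | "a \<noteq> j" "b = j" | "a \<noteq> j" "b \<noteq> j" using ab(3) by blast
  then show ?thesis
  proof cases
    case 1
    then have "fst (\<sigma> ! j) \<inter> fst (\<sigma> ! b) \<noteq> {} \<or> R \<inter> fst (\<sigma> ! b) \<noteq> {}" using ab assms by auto
    then show ?thesis using 1 ab(1,2) unfolding overlap_def by blast
  next
    case 2
    then have "fst (\<sigma> ! a) \<inter> fst (\<sigma> ! j) \<noteq> {} \<or> R \<inter> fst (\<sigma> ! a) \<noteq> {}" using ab assms by auto
    then show ?thesis using 2 ab(1,2) unfolding overlap_def by blast
  next
    case 3
    then have "fst (\<sigma> ! a) \<inter> fst (\<sigma> ! b) \<noteq> {}" using ab(4) by simp
    then show ?thesis using ab(1-3) unfolding overlap_def by blast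
  qed
qed

text \<open>The added sum bounds the number of starting points that create an overlap with another
  instance. The potential depends only on run lengths, so \<open>V\<close> and \<open>ys\<close> may
  be arbitrary and the increase is the same for every outcome of the draw.\<close>

lemma potential_draw:
  assumes "consistent m P h \<sigma>" "j < length \<sigma>" "fst (snd (\<sigma> ! j)) = r" "r \<ge> 1"
  shows "potential m \<sigma> + 2 / real m * (\<Sum>i\<in>{..<length \<sigma>} - {j}. runs_drawn (\<sigma> ! i) * r + ids_reserved (\<sigma> ! i))
    \<le> potential m (\<sigma>[j := (V, 2 * r, ys)])"
proof -
  let ?I = "{..<length \<sigma>} - {j}"
  define K where "K = (\<Sum>i\<in>?I. runs_drawn (\<sigma> ! i))"
  define L where "L = (\<Sum>i\<in>?I. ids_reserved (\<sigma> ! i))"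
  have 0: "0 \<le> K" "0 \<le> L" unfolding K_def L_def
    using runs_drawn_nonneg[OF assms(1)] ids_reserved_nonneg[OF assms(1)] by (auto intro!: sum_nonneg)
  have split: "(\<Sum>i<length \<sigma>. f i) = f j + (\<Sum>i\<in>?I. f i)" for f :: "nat \<Rightarrow> real"
    using assms(2) by (intro sum.remove) auto
  let ?\<sigma>' = "\<sigma>[j := (V, 2 * r, ys)]"
  have K': "(\<Sum>i<length ?\<sigma>'. runs_drawn (?\<sigma>' ! i)) = 1 + log 2 r + K"
    using assms(2,4) unfolding K_def length_list_update split by (simp add: log_mult)
  have L': "(\<Sum>i<length ?\<sigma>'. ids_reserved (?\<sigma>' ! i)) = 2 * r - 1 + L"
    using assms(2,4) unfolding L_def length_list_update split by simp
  have 1: "(\<Sum>i<length \<sigma>. runs_drawn (\<sigma> ! i)) = log 2 r + K"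
    using assms(3) unfolding K_def split by simp
  have 2: "(\<Sum>i<length \<sigma>. ids_reserved (\<sigma> ! i)) = r - 1 + L"
    using assms(3,4) unfolding L_def split by (simp add: of_nat_diff)
  have 3: "(\<Sum>i\<in>?I. runs_drawn (\<sigma> ! i) * r + ids_reserved (\<sigma> ! i)) = K * r + L"
    by (simp add: K_def L_def sum.distrib sum_distrib_right sum_subtractf)
  \<comment> \<open>The product grows by \<open>K * r + L\<close> plus the contribution
    \<open>2 * r - 1 + r * log 2 r\<close> of instance \<open>j\<close> with itself, which is
    nonnegative.\<close>
  have "0 \<le> real r * log 2 r" "1 \<le> real r" using assms(4) by simp_all
  then have "1 \<le> real r * 2 + real r * log 2 r" by linarith
  then have "(log 2 r + K) * (r - 1 + L) + (K * r + L) \<le> (1 + log 2 r + K) * (2 * r - 1 + L)"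
    using 0 assms(4) by (auto simp: algebra_simps of_nat_diff)
  then show ?thesis
    unfolding potential_def K' L' 1 2 3 by (simp only: distrib_left[symmetric]) (intro mult_left_mono; simp)
qed

section \<open>The effect of a single answer\<close>

text \<open>
  An activation is treated as a request to an instance in the initial state with demand 0, whence
  the profile \<open>P\<close>, which need not be that of \<open>h\<close>.
\<close>
lemma bind_answer_le:
  assumes "m \<ge> 1" "consistent m P h \<sigma>" "j < length P"
    and bound: "real (P ! j + 1) \<le> real m / (2 * log 2 (real m))"
    and f: "\<And>y s. \<lbrakk>y \<in> {1..m}; (j, y) \<notin> set h; consistent m (P[j := P ! j + 1]) ((j, y) # h) (\<sigma>[j := s])\<rbrakk>
      \<Longrightarrow> measure (measure_spmf (f (y, s))) A \<le> of_bool (overlap (\<sigma>[j := s])) + B - potential m (\<sigma>[j := s])"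
  shows "measure (measure_spmf (bind_spmf (cluster_star_answer m (\<sigma> ! j)) f)) A
    \<le> of_bool (overlap \<sigma>) + B - potential m \<sigma>"
proof -
  obtain U r ys where s: "\<sigma> ! j = (U, r, ys)" by (cases "\<sigma> ! j")
  have len: "length \<sigma> = length P" using assms(2) by (simp add: consistent_def)
  note ok = consistent_instance_ok[OF assms(2,3), unfolded s]
  then obtain k where k: "r = 2 ^ k" "reserved m k U" by auto
  have U: "U \<subseteq> {1..m}" using reserved_subset[OF k(2) assms(1)] .
  show ?thesis
  proof (cases ys)
    case (Cons y ys')
    \<comment> \<open>A pending ID is handed out: no randomness is involved, and the reserved set
      and the next run length stay the same.\<close>
    have c: "consistent m (P[j := P ! j + 1]) ((j, y) # h) (\<sigma>[j := (U, r, ys')])"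
      using ok Cons by (intro consistent_update[OF assms(2,3)]) auto
    have "fst (\<sigma>[j := (U, r, ys')] ! i) = fst (\<sigma> ! i) \<and>
        fst (snd (\<sigma>[j := (U, r, ys')] ! i)) = fst (snd (\<sigma> ! i))" for i
      using assms(3) len s by (cases "i = j") auto
    then have "overlap (\<sigma>[j := (U, r, ys')]) = overlap \<sigma>"
      "potential m (\<sigma>[j := (U, r, ys')]) = potential m \<sigma>"
      by (simp_all add: overlap_def potential_def)
    moreover have "y \<in> {1..m}" "(j, y) \<notin> set h" using ok Cons U by auto
    ultimately show ?thesis using f[OF _ _ c] by (simp add: s Cons)
  next
    case Nil
    \<comment> \<open>With no pending IDs the invariant equates the length of the next run with the
      demand after this request, so \<open>bound\<close> applies to that length.\<close>
    with ok have r: "r = P ! j + 1" by simp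
    let ?S = "{x \<in> {1..m}. set (run m x r) \<inter> U = {}}"
    let ?t = "\<lambda>x. (U \<union> set (run m x r), 2 * r, tl (run m x r))"
    let ?I = "{..<length \<sigma>} - {j}"
    have bk: "2 ^ k \<le> real m / (2 * log 2 (real m))"
      using bound k(1) r by (metis of_nat_numeral of_nat_power)
    have S: "real m / 2 \<le> real (card ?S)"
      using card_admissible[OF k(2) assms(1) bk] k(1) by simp
    then have Spos: "0 < real (card ?S)" using assms(1) by linarith
    have "r \<le> m" using run_count_bound(2)[OF assms(1) bk] k(1) by simp
    \<comment> \<open>The potential after the draw is the same for all \<open>x\<close>, so it is
      computed with placeholder components.\<close>
    define \<Phi> where "\<Phi> = potential m (\<sigma>[j := (U, 2 * r, [])])"
    have \<Phi>: "potential m (\<sigma>[j := ?t x]) = \<Phi>" for x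
    proof -
      have "fst (snd (\<sigma>[j := ?t x] ! i)) = fst (snd (\<sigma>[j := (U, 2 * r, [])] ! i))" for i
        using assms(3) len by (cases "i = j") auto
      then show ?thesis by (simp add: potential_def \<Phi>_def)
    qed
    have step: "measure (measure_spmf (f (hd (run m x r), ?t x))) A \<le> of_bool (overlap (\<sigma>[j := ?t x])) + B - \<Phi>"
      if x: "x \<in> ?S" for x
    proof -
      define y where "y = hd (run m x r)"
      define zs where "zs = tl (run m x r)"
      have run: "run m x r = y # zs" using r by (simp add: y_def zs_def run_def)
      have d: "distinct (run m x r)" using \<open>r \<le> m\<close> by (rule distinct_run)
      have lz: "length zs + 1 = r" using arg_cong[OF run, of length] by (simp add: run_def)
      have sub: "set (run m x r) \<subseteq> {1..m}" using assms(1) by (rule set_run_subset)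
      have disj: "set (run m x r) \<inter> U = {}" using x by simp
      have "reserved m (Suc k) (U \<union> set (run m x r))"
        using reserved_Suc[OF k(2)] x k(1) by simp
      moreover have "2 * r = 2 ^ Suc k" using k(1) by simp
      ultimately have ok': "instance_ok m (P ! j + 1) (insert y {y. (j, y) \<in> set h}) (U \<union> set (run m x r), 2 * r, zs)"
        using ok d disj lz r unfolding run by (auto simp del: power_Suc)
      have c: "consistent m (P[j := P ! j + 1]) ((j, y) # h) (\<sigma>[j := ?t x])"
        using consistent_update[OF assms(2,3) ok'] by (simp add: zs_def)
      have "y \<in> {1..m}" "(j, y) \<notin> set h" using sub disj ok unfolding run by auto
      from f[OF this c] show ?thesis unfolding \<Phi> y_def .
    qed
    have ov: "of_bool (overlap (\<sigma>[j := ?t x])) \<le>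
        of_bool (overlap \<sigma>) + (\<Sum>i\<in>?I. of_bool (set (run m x r) \<inter> fst (\<sigma> ! i) \<noteq> {}) :: real)" for x
    proof (cases "overlap (\<sigma>[j := ?t x]) \<and> \<not> overlap \<sigma>")
      case True
      then obtain i where i: "i \<in> ?I" "set (run m x r) \<inter> fst (\<sigma> ! i) \<noteq> {}"
        using overlap_update[of \<sigma> j U "set (run m x r)" "2 * r" "tl (run m x r)"] assms(3) len s
        by (metis fst_conv)
      have "of_bool (set (run m x r) \<inter> fst (\<sigma> ! i) \<noteq> {}) \<le>
          (\<Sum>i\<in>?I. of_bool (set (run m x r) \<inter> fst (\<sigma> ! i) \<noteq> {}) :: real)"
        using i(1) by (intro member_le_sum) auto
      with i(2) True show ?thesis by simp
    next
      case False
      have "0 \<le> (\<Sum>i\<in>?I. of_bool (set (run m x r) \<inter> fst (\<sigma> ! i) \<noteq> {}) :: real)" by (intro sum_nonneg) auto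
      with False show ?thesis by auto
    qed
    \<comment> \<open>Enlarging the range from the admissible starting points to all of
      \<open>{1..m}\<close> reduces this to the counting lemma.\<close>
    have meet: "(\<Sum>x\<in>?S. of_bool (set (run m x r) \<inter> fst (\<sigma> ! i) \<noteq> {})) \<le> runs_drawn (\<sigma> ! i) * r + ids_reserved (\<sigma> ! i)"
      if i: "i \<in> ?I" for i
    proof -
      have "(\<Sum>x\<in>?S. of_bool (set (run m x r) \<inter> fst (\<sigma> ! i) \<noteq> {}) :: real) \<le>
          (\<Sum>x\<in>{1..m}. of_bool (set (run m x r) \<inter> fst (\<sigma> ! i) \<noteq> {}))"
        by (intro sum_mono2) auto
      also have "\<dots> = real (card {x \<in> {1..m}. set (run m x r) \<inter> fst (\<sigma> ! i) \<noteq> {}})"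
        by (simp add: Int_def)
      also have "\<dots> \<le> runs_drawn (\<sigma> ! i) * r + ids_reserved (\<sigma> ! i)"
        using i len by (intro card_runs_meeting_instance[OF consistent_instance_ok[OF assms(2)] assms(1)]) auto
      finally show ?thesis .
    qed
    define C where "C = (\<Sum>i\<in>?I. runs_drawn (\<sigma> ! i) * r + ids_reserved (\<sigma> ! i))"
    have "0 \<le> C" unfolding C_def
      using runs_drawn_nonneg[OF assms(2)] ids_reserved_nonneg[OF assms(2)]
      by (intro sum_nonneg add_nonneg_nonneg mult_nonneg_nonneg) auto
    \<comment> \<open>Averaging over the uniform draw: exchanging the sums gives at most
      \<open>C\<close> bad events, hence the term \<open>C / card ?S\<close>, at most
      \<open>2 / m * C\<close>.\<close>
    have "(\<Sum>x\<in>?S. measure (measure_spmf (f (hd (run m x r), ?t x))) A)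
        \<le> (\<Sum>x\<in>?S. (of_bool (overlap \<sigma>) + B - \<Phi>) + (\<Sum>i\<in>?I. of_bool (set (run m x r) \<inter> fst (\<sigma> ! i) \<noteq> {})))"
      using step ov by (intro sum_mono) (smt (verit))
    also have "\<dots> = real (card ?S) * (of_bool (overlap \<sigma>) + B - \<Phi>) +
        (\<Sum>i\<in>?I. \<Sum>x\<in>?S. of_bool (set (run m x r) \<inter> fst (\<sigma> ! i) \<noteq> {}))"
      by (subst sum.swap) (simp only: sum.distrib sum_constant)
    also have "\<dots> \<le> real (card ?S) * (of_bool (overlap \<sigma>) + B - \<Phi>) + C"
      unfolding C_def by (intro add_left_mono sum_mono meet)
    finally have "(\<Sum>x\<in>?S. measure (measure_spmf (f (hd (run m x r), ?t x))) A) / card ?S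
        \<le> (real (card ?S) * (of_bool (overlap \<sigma>) + B - \<Phi>) + C) / card ?S"
      by (rule divide_right_mono) simp
    also have "\<dots> = of_bool (overlap \<sigma>) + B - \<Phi> + C / card ?S"
      using Spos by (subst add_divide_distrib) (simp only: nonzero_mult_div_cancel_left order_less_imp_not_eq2 not_False_eq_True)
    also have "C / card ?S \<le> C / (real m / 2)"
      using S \<open>0 \<le> C\<close> assms(1) by (intro divide_left_mono) auto
    also have "of_bool (overlap \<sigma>) + B - \<Phi> + C / (real m / 2) = of_bool (overlap \<sigma>) + B - \<Phi> + 2 / real m * C"
      by simp
    \<comment> \<open>The increase of the potential pays for the new overlaps.\<close>
    also have "\<dots> \<le> of_bool (overlap \<sigma>) + B - potential m \<sigma>"
      using potential_draw[OF assms(2), of j r U "[]"] assms(3) len s r by (simp add: C_def \<Phi>_def)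
    finally show ?thesis
      by (simp add: s Nil map_spmf_conv_bind_spmf measure_bind_spmf integral_spmf_of_set)
  qed
qed


section \<open>Induction along the play\<close>

text \<open>Each instance answers only with IDs from its reserved set, so a shared ID lies in two of
  these sets.\<close>

lemma collision_imp_overlap:
  assumes "legal h" "consistent m (profile h) h \<sigma>" "collision h"
  shows "overlap \<sigma>"
proof -
  obtain i j y where ij: "i \<noteq> j" "(i, y) \<in> set h" "(j, y) \<in> set h"
    using assms(3) by (auto simp: collision_def)
  have *: "k < length \<sigma>" "y \<in> fst (\<sigma> ! k)" if "(k, y) \<in> set h" for k
  proof -
    have k: "k < length (profile h)" using legal_index_less[OF assms(1) that] .
    then show "k < length \<sigma>" using assms(2) by (simp add: consistent_def)
    show "y \<in> fst (\<sigma> ! k)"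
      using consistent_instance_ok[OF assms(2) k] that by (cases "\<sigma> ! k") auto
  qed
  then show ?thesis unfolding overlap_def using ij by blast
qed

lemma consistent_new_instance:
  assumes "legal h" "consistent m (profile h) h \<sigma>"
  shows "consistent m (profile h @ [0]) h (\<sigma> @ [({}, 1, [])])"
proof -
  have "reserved m 0 {}" by (rule reserved_0)
  then have "\<exists>k. Suc 0 = 2 ^ k \<and> reserved m k {}" by (intro exI[of _ 0]) simp
  moreover have "{y. (length (profile h), y) \<in> set h} = {}"
    using legal_index_less[OF assms(1)] by blast
  ultimately show ?thesis using assms(2)
    by (auto simp: consistent_def nth_append less_Suc_eq)
qed

lemma overlap_new_instance: "overlap (\<sigma> @ [({}, 1, [])]) = overlap \<sigma>"
  unfolding overlap_def length_append_singleton
  by (auto simp: nth_append less_Suc_eq)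

text \<open>The initial state has next run length 1, hence \<open>log 2 1 = 0\<close> runs and
  \<open>1 - 1 = 0\<close> reserved IDs.\<close>

lemma potential_new_instance: "potential m (\<sigma> @ [({}, 1, [])]) = potential m \<sigma>"
  by (simp add: potential_def nth_append)

text \<open>The right-hand side is a supermartingale along the play: by
  \<open>bind_answer_le\<close> no answer raises it on average. When the adversary stops, the
  potential is at most \<open>B\<close>, so the overlap indicator remains as a lower bound and
  dominates that of a collision.\<close>

lemma measure_play_collision_le:
  assumes "always_stops m \<D> Z h" "legal h" "consistent m (profile h) h \<sigma>" and m: "m \<ge> 1"
    and bound: "\<And>D x. D \<in> \<D> \<Longrightarrow> x \<in> set D \<Longrightarrow> real x \<le> real m / (2 * log 2 (real m))"
    and pot: "\<And>D h \<sigma>. D \<in> \<D> \<Longrightarrow> consistent m D h \<sigma> \<Longrightarrow> potential m \<sigma> \<le> B"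
  shows "measure (measure_spmf (play (cluster_star m) Z h \<sigma>)) {h. collision h}
    \<le> of_bool (overlap \<sigma>) + B - potential m \<sigma>"
  using assms(1-3)
proof (induction arbitrary: \<sigma> rule: always_stops.induct)
  case (1 h)
  let ?A = "{h. collision h}"
  have len: "length \<sigma> = length (profile h)" using "1.prems"(2) by (simp add: consistent_def)
  \<comment> \<open>This is applied to the history after the pending request, whose demand limits
    the length of a run drawn now.\<close>
  have small: "real (profile h' ! j) \<le> real m / (2 * log 2 (real m))"
    if "always_stops m \<D> Z h'" "legal h'" "j < length (profile h')" for h' j
  proof -
    from always_stops_profile_le[OF that(1,2) m] that(3)
    obtain D where D: "D \<in> \<D>" "j < length D" "profile h' ! j \<le> D ! j"
      by (meson less_le_trans)
    have "real (profile h' ! j) \<le> real (D ! j)" using D(3) by simp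
    also have "\<dots> \<le> real m / (2 * log 2 (real m))" using D(1,2) by (intro bound) auto
    finally show ?thesis .
  qed
  show ?case
    unfolding play.simps[of _ _ h]
  proof (rule measure_bind_spmf_of_pmf_le, goal_cases)
    case (1 a)
    show ?case
    proof (cases a)
      case Stop
      with 1 have "potential m \<sigma> \<le> B" using "1.hyps"(1) "1.prems"(2) pot by blast
      moreover have "measure (measure_spmf (return_spmf h)) ?A \<le> of_bool (overlap \<sigma>)"
        using collision_imp_overlap[OF "1.prems"] by (auto simp: measure_spmf_return_spmf measure_return indicator_def)
      ultimately show ?thesis by (simp add: Stop)
    next
      case Activate
      let ?j = "length (profile h)" and ?P = "profile h @ [0]" and ?\<sigma> = "\<sigma> @ [({}, 1, [])]"
      let ?f = "\<lambda>(y, s). play (cluster_star m) Z ((length \<sigma>, y) # h) (\<sigma> @ [s])"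
      have P: "?P[?j := ?P ! ?j + 1] = profile ((?j, y) # h)" for y
        by (simp add: profile_Activate del: profile.simps)
      have \<sigma>: "?\<sigma>[?j := s] = \<sigma> @ [s]" for s by (simp flip: len)
      have legal: "legal ((?j, y) # h)" for y using "1.prems"(1) by simp
      \<comment> \<open>One possible answer suffices as a witness, since the successor profile does
        not depend on the ID.\<close>
      have "1 \<in> {1..m}" using m by simp
      then have "always_stops m \<D> Z ((?j, 1) # h)" using "1.hyps"(2) 1 Activate by blast
      from small[OF this legal, of ?j]
      have b: "real (?P ! ?j + 1) \<le> real m / (2 * log 2 (real m))"
        by (simp add: profile_Activate del: profile.simps)
      have "measure (measure_spmf (bind_spmf (cluster_star_answer m (?\<sigma> ! ?j)) ?f)) ?A
        \<le> of_bool (overlap ?\<sigma>) + B - potential m ?\<sigma>"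
      proof (rule bind_answer_le[OF m consistent_new_instance[OF "1.prems"] _ b], goal_cases)
        case (2 y s)
        then show ?case using "1.IH"(1)[of y "\<sigma> @ [s]"] legal 1 Activate
          unfolding P \<sigma> by (simp add: len)
      qed simp
      then show ?thesis
        unfolding overlap_new_instance potential_new_instance
        by (simp add: Activate cluster_star_def flip: len)
    next
      case (Request j)
      let ?f = "\<lambda>(y, s). play (cluster_star m) Z ((j, y) # h) (\<sigma>[j := s])"
      have j: "j < length (profile h)" "profile h ! j < m" using "1.hyps"(3) 1 Request by auto
      have legal: "legal ((j, y) # h)" for y using "1.prems"(1) j by simp
      obtain y where "y \<in> {1..m}" "(j, y) \<notin> set h" using fresh_answer[OF "1.prems"(1) j] by blast
      then have "always_stops m \<D> Z ((j, y) # h)" using "1.hyps"(4) 1 Request by blast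
      from small[OF this legal, of j] have b: "real (profile h ! j + 1) \<le> real m / (2 * log 2 (real m))"
        using j(1) by (simp add: profile_Request del: profile.simps)
      have "measure (measure_spmf (bind_spmf (cluster_star_answer m (\<sigma> ! j)) ?f)) ?A
        \<le> of_bool (overlap \<sigma>) + B - potential m \<sigma>"
      proof (rule bind_answer_le[OF m "1.prems"(2) j(1) b], goal_cases)
        case (1 y s)
        then show ?case using "1.IH"(2)[of j y "\<sigma>[j := s]"] legal \<open>a \<in> set_pmf (Z h)\<close> Request
          unfolding profile_Request[OF j(1), symmetric, of y] by simp
      qed
      then show ?thesis by (simp add: Request cluster_star_def)
    qed
  qed
qed

section \<open>The largest final potential\<close>

lemma sum_ln_le:
  fixes x :: "nat \<Rightarrow> real"
  assumes "\<And>i. i < l \<Longrightarrow> 0 \<le> x i" "(\<Sum>i<l. x i) = d" "l \<le> n" "0 < n"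
  shows "(\<Sum>i<l. ln (1 + x i)) \<le> real n * ln (1 + d / real n)"
proof -
  define a where "a = d / real n"
  have "0 \<le> d" using assms(1) by (auto intro!: sum_nonneg simp: assms(2)[symmetric])
  then have a: "0 \<le> a" by (simp add: a_def)
  have d: "d = real n * a" using assms(4) by (simp add: a_def)
  \<comment> \<open>Jensen's inequality via the tangent at \<open>a\<close>, which also covers the \<open>n - l\<close> missing terms as zeros.\<close>
  have tangent: "ln (1 + t) \<le> ln (1 + a) + (t - a) / (1 + a)" if "0 \<le> t" for t
  proof -
    have "ln ((1 + t) / (1 + a)) \<le> (1 + t) / (1 + a) - 1"
      using a that by (intro ln_le_minus_one) auto
    also have "\<dots> = (t - a) / (1 + a)" using a by (simp add: field_simps)
    finally show ?thesis using a that by (simp add: ln_div)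
  qed
  have "(\<Sum>i<l. ln (1 + x i)) \<le> (\<Sum>i<l. ln (1 + a) + (x i - a) / (1 + a))"
    using assms(1) by (intro sum_mono tangent) auto
  also have "\<dots> = real l * (ln (1 + a) - a / (1 + a)) + d / (1 + a)"
    by (simp add: sum.distrib diff_divide_distrib sum_subtractf assms(2)[symmetric] sum_divide_distrib algebra_simps)
  \<comment> \<open>The tangent bound at \<open>t = 0\<close> shows that the factor of
    \<open>l\<close> is nonnegative, so \<open>l\<close> may be raised to \<open>n\<close>.\<close>
  also have "\<dots> \<le> real n * (ln (1 + a) - a / (1 + a)) + d / (1 + a)"
    using tangent[of 0] assms(3) by (intro add_right_mono mult_right_mono) auto
  also have "\<dots> = real n * ln (1 + a)" by (simp add: d algebra_simps)
  finally show ?thesis by (simp add: a_def)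
qed

text \<open>The constant 8 is a product of three factors 2: one in the potential, one from
  \<open>ln r \<le> 2 * ln (1 + p)\<close> and one from \<open>r - 1 \<le> 2 * p\<close>, where
  \<open>p\<close> is the demand of an instance and \<open>r\<close> its next run length.\<close>

lemma potential_le:
  assumes "consistent m D h \<sigma>" "length D \<le> n" "0 < n" "sum_list D = d"
  shows "potential m \<sigma> \<le> 8 * (real n * real d / real m * log 2 (1 + real d / real n))"
proof -
  have len: "length \<sigma> = length D" using assms(1) by (simp add: consistent_def)
  have d: "(\<Sum>i<length \<sigma>. real (D ! i)) = real d"
    using assms(4) by (simp add: len sum_list_sum_nth atLeast0LessThan flip: of_nat_sum)
  have r: "1 \<le> fst (snd (\<sigma> ! i)) \<and> fst (snd (\<sigma> ! i)) \<le> 2 * D ! i + 1" if "i < length \<sigma>" for i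
    using consistent_instance_ok[OF assms(1), of i] that len by (cases "\<sigma> ! i") auto
  have "runs_drawn (\<sigma> ! i) \<le> 2 / ln 2 * ln (1 + real (D ! i))" if i: "i < length \<sigma>" for i
  proof -
    have "real (fst (snd (\<sigma> ! i))) \<le> real (2 * D ! i + 1)" using r[OF i] by (intro of_nat_mono) simp
    \<comment> \<open>Passing to the square costs a factor 2 in the logarithm and produces the form
      \<open>ln (1 + x)\<close> required by \<open>sum_ln_le\<close>.\<close>
    also have "\<dots> \<le> (1 + real (D ! i)) ^ 2" by (simp add: power2_eq_square algebra_simps)
    finally have "ln (real (fst (snd (\<sigma> ! i)))) \<le> ln ((1 + real (D ! i)) ^ 2)"
      using r[OF i] by (subst ln_le_cancel_iff) auto
    also have "\<dots> = 2 * ln (1 + real (D ! i))" by (simp add: ln_realpow)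
    finally show ?thesis by (simp add: log_def divide_right_mono)
  qed
  then have "(\<Sum>i<length \<sigma>. runs_drawn (\<sigma> ! i)) \<le> (\<Sum>i<length \<sigma>. 2 / ln 2 * ln (1 + real (D ! i)))"
    by (intro sum_mono) auto
  also have "\<dots> \<le> 2 / ln 2 * (real n * ln (1 + real d / real n))"
    unfolding sum_distrib_left[symmetric] using assms(2,3) len d
    by (intro mult_left_mono sum_ln_le) auto
  finally have K: "(\<Sum>i<length \<sigma>. runs_drawn (\<sigma> ! i)) \<le> 2 * (real n * log 2 (1 + real d / real n))"
    by (simp add: log_def)
  have "(\<Sum>i<length \<sigma>. ids_reserved (\<sigma> ! i)) \<le> (\<Sum>i<length \<sigma>. 2 * real (D ! i))"
    using r by (intro sum_mono) force
  then have L: "(\<Sum>i<length \<sigma>. ids_reserved (\<sigma> ! i)) \<le> 2 * real d"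
    by (simp only: sum_distrib_left[symmetric] d)
  have "0 \<le> log 2 (1 + real d / real n)" using assms(3) by (subst zero_le_log_cancel_iff) (auto intro: add_pos_nonneg)
  then have "potential m \<sigma> \<le> 2 / real m * ((2 * (real n * log 2 (1 + real d / real n))) * (2 * real d))"
    unfolding potential_def using ids_reserved_nonneg[OF assms(1)]
    by (intro mult_left_mono mult_mono K L sum_nonneg) auto
  then show ?thesis by (simp add: mult_ac)
qed

theorem theorem3p8:
  shows "\<exists>c::real. c > 0 \<and>
    (\<forall>(m::nat) (n::nat) (d::nat). m \<ge> 1 \<longrightarrow> n \<ge> 2 \<longrightarrow> d \<ge> n \<longrightarrow>
      (SUP Z \<in> Adv m (D1 m d \<inter> Dinf_le n (real m / (2 * log 2 (real m)))).
          ereal (collision_prob (cluster_star m) Z))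
        \<le> ereal (c * min 1 (real n * real d / real m * log 2 (1 + real d / real n))))"
proof (intro exI[of _ 8] conjI allI impI SUP_least)
  \<comment> \<open>Bounding each adversary also covers an empty set of adversaries, whose supremum
    in \<open>ereal\<close> is minus infinity.\<close>
  fix m n d :: nat and Z
  let ?\<D> = "D1 m d \<inter> Dinf_le n (real m / (2 * log 2 (real m)))"
  let ?b = "real n * real d / real m * log 2 (1 + real d / real n)"
  assume m: "m \<ge> 1" and n: "n \<ge> 2" and Z: "Z \<in> Adv m ?\<D>"
  \<comment> \<open>The play starts without instances, hence with no overlap and potential 0, so
    only the bound on the final potential remains.\<close>
  have "collision_prob (cluster_star m) Z \<le> of_bool (overlap []) + 8 * ?b - potential m []"
    unfolding collision_prob_def
  proof (rule measure_play_collision_le[OF _ _ _ m])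
    show "always_stops m ?\<D> Z []" using Z by (simp add: Adv_def)
    show "consistent m (profile []) [] []" by (simp add: consistent_def)
    show "real x \<le> real m / (2 * log 2 (real m))" if "D \<in> ?\<D>" "x \<in> set D" for D x
      using that by (auto simp: Dinf_le_def)
    show "potential m \<sigma> \<le> 8 * ?b" if "D \<in> ?\<D>" "consistent m D h \<sigma>" for D h \<sigma>
      using that n by (intro potential_le[of m D h]) (auto simp: D1_def D1_len_def Dinf_le_def)
  qed simp
  then have "collision_prob (cluster_star m) Z \<le> 8 * ?b"
    by (simp add: overlap_def potential_def)
  moreover have "collision_prob (cluster_star m) Z \<le> 1"
    by (simp add: collision_prob_def measure_spmf.subprob_measure_le_1)
  ultimately have "collision_prob (cluster_star m) Z \<le> 8 * min 1 ?b"
    by (simp add: min_def)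
  then show "ereal (collision_prob (cluster_star m) Z) \<le> ereal (8 * min 1 ?b)" by simp
qed simp

end
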